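(* Let $\ell, r \geq 1$ be integers. Every finite simple transversal matroid of rank $r$ with no minor isomorphic to $U_{2,\ell+2}$ has at most $\ell(r-1)+1$ elements.
   Context: All matroids are finite. A matroid is simple if it has no loops and no parallel pairs. A minor of a matroid is a matroid obtained from it by a sequence of deletions and contractions. For integers $0 \leq k \leq m$, the uniform matroid $U_{k,m}$ is the matroid on an $m$-element ground set whose independent sets are precisely the subsets of size at most $k$. Transversal matroids: an indexed family $(P_1,\ldots,P_b)$ of subsets of a finite set $E$ (members may repeat, repeated members having distinct indices) presents the matroid on $E$ whose independent sets are precisely the sets $I \subseteq E$ admitting an injection $f : I \to \{1,\ldots,b\}$ with $x \in P_{f(x)}$ for every $x \in I$. A matroid having such a presentation is called transversal. *)

theory Defs
  imports Main
begin

record 'a indep_system =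
  ground :: "'a set"
  indeps :: "'a set set"

locale matroid =
  fixes M :: "'a indep_system"
  assumes finite_ground: "finite (ground M)"
    and indep_subset_ground: "X \<in> indeps M \<Longrightarrow> X \<subseteq> ground M"
    and empty_indep: "{} \<in> indeps M"
    and indep_subset: "X \<in> indeps M \<Longrightarrow> Y \<subseteq> X \<Longrightarrow> Y \<in> indeps M"
    and augment: "X \<in> indeps M \<Longrightarrow> Y \<in> indeps M \<Longrightarrow> card X < card Y \<Longrightarrow>
      \<exists>y \<in> Y - X. insert y X \<in> indeps M"

definition matroid_rank :: "'a indep_system \<Rightarrow> nat" where
  "matroid_rank M = Max (card ` indeps M)"

definition is_loop :: "'a indep_system \<Rightarrow> 'a \<Rightarrow> bool" where
  "is_loop M x \<longleftrightarrow> x \<in> ground M \<and> {x} \<notin> indeps M"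

definition is_parallel_pair :: "'a indep_system \<Rightarrow> 'a \<Rightarrow> 'a \<Rightarrow> bool" where
  "is_parallel_pair M x y \<longleftrightarrow> x \<in> ground M \<and> y \<in> ground M \<and> x \<noteq> y \<and>
    \<not> is_loop M x \<and> \<not> is_loop M y \<and> {x, y} \<notin> indeps M"

definition simple_matroid :: "'a indep_system \<Rightarrow> bool" where
  "simple_matroid M \<longleftrightarrow> matroid M \<and> (\<forall>x. \<not> is_loop M x) \<and> (\<forall>x y. \<not> is_parallel_pair M x y)"

definition is_basis_of :: "'a indep_system \<Rightarrow> 'a set \<Rightarrow> 'a set \<Rightarrow> bool" where
  "is_basis_of M X B \<longleftrightarrow> B \<subseteq> X \<and> B \<in> indeps M \<and>
    (\<forall>C. B \<subseteq> C \<and> C \<subseteq> X \<and> C \<in> indeps M \<longrightarrow> C = B)"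

definition delete :: "'a indep_system \<Rightarrow> 'a set \<Rightarrow> 'a indep_system" where
  "delete M X = \<lparr>ground = ground M - X, indeps = {I \<in> indeps M. I \<inter> X = {}}\<rparr>"

(* In a matroid the choice of the basis B of X does not matter. *)
definition contract :: "'a indep_system \<Rightarrow> 'a set \<Rightarrow> 'a indep_system" where
  "contract M X = \<lparr>ground = ground M - X,
    indeps = {I. I \<subseteq> ground M - X \<and> (\<exists>B. is_basis_of M X B \<and> I \<union> B \<in> indeps M)}\<rparr>"

inductive is_minor :: "'a indep_system \<Rightarrow> 'a indep_system \<Rightarrow> bool" for M where
  minor_refl: "is_minor M M"
| minor_delete: "is_minor M N \<Longrightarrow> X \<subseteq> ground N \<Longrightarrow> is_minor M (delete N X)"
| minor_contract: "is_minor M N \<Longrightarrow> X \<subseteq> ground N \<Longrightarrow> is_minor M (contract N X)"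

definition isomorphic_to :: "'a indep_system \<Rightarrow> 'b indep_system \<Rightarrow> bool" where
  "isomorphic_to M N \<longleftrightarrow> (\<exists>f. bij_betw f (ground M) (ground N) \<and>
    (\<forall>X. X \<subseteq> ground M \<longrightarrow> (X \<in> indeps M \<longleftrightarrow> f ` X \<in> indeps N)))"

definition uniform_matroid :: "nat \<Rightarrow> nat \<Rightarrow> nat indep_system" where
  "uniform_matroid k m = \<lparr>ground = {..<m}, indeps = {X. X \<subseteq> {..<m} \<and> card X \<le> k}\<rparr>"

definition presentation :: "'a indep_system \<Rightarrow> nat \<Rightarrow> (nat \<Rightarrow> 'a set) \<Rightarrow> bool" where
  "presentation M b P \<longleftrightarrow> (\<forall>i \<in> {1..b}. P i \<subseteq> ground M) \<and>
    indeps M = {I. I \<subseteq> ground M \<and>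
      (\<exists>f. inj_on f I \<and> f ` I \<subseteq> {1..b} \<and> (\<forall>x \<in> I. x \<in> P (f x)))}"

definition transversal_matroid :: "'a indep_system \<Rightarrow> bool" where
  "transversal_matroid M \<longleftrightarrow> matroid M \<and> (\<exists>b P. presentation M b P)"

end

theory Submission
  imports Defs
begin

text \<open>
  Write \<open>S e\<close> for the set of indices \<open>i\<close> with \<open>e \<in> P\<^sub>i\<close>. Restricting the presentation to the \<open>r\<close> indices
  matched to a fixed basis keeps every \<open>S e\<close> nonempty and no two elements get the same singleton
  support. It may make the matroid less free, but every basis found this way is a basis of \<open>M\<close>, so it
  suffices to find disjoint \<open>C\<close> and \<open>X\<close> with \<open>card X = l + 2\<close> such that \<open>C \<union> {x, y}\<close> is matched onto the
  \<open>r\<close> indices for all distinct \<open>x, y \<in> X\<close>. This is done by induction on \<open>r\<close>. If all supports are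
  singletons there are at most \<open>r\<close> elements. Otherwise choose \<open>e\<close> and distinct \<open>i, j \<in> S e\<close>, and shrink the
  support of \<open>e\<close> to \<open>{i, j}\<close>. The elements with support inside \<open>{i, j}\<close> form a line. If it has at least
  \<open>l + 2\<close> elements we are done; otherwise contract \<open>e\<close>, which amounts to merging \<open>i\<close> and \<open>j\<close>. The line
  becomes a single point, so at most \<open>l\<close> elements are lost.
\<close>

section \<open>Systems of distinct representatives\<close>

text \<open>This is a perfect matching between indices and elements, directed from indices to
  elements so that rematching an index is a function update.\<close>

definition sdr :: "('a \<Rightarrow> 'i set) \<Rightarrow> 'i set \<Rightarrow> 'a set \<Rightarrow> ('i \<Rightarrow> 'a) \<Rightarrow> bool" where
  "sdr S J A f \<longleftrightarrow> bij_betw f J A \<and> (\<forall>k\<in>J. k \<in> S (f k))"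

lemma sdr_upd:
  assumes "sdr S J A f" "i \<notin> J" "x \<notin> A" "i \<in> S x"
  shows "sdr S (insert i J) (insert x A) (f(i := x))"
proof -
  have "bij_betw (f(i := x)) J A"
    using assms(1,2) unfolding sdr_def by (metis bij_betw_cong fun_upd_other)
  then have "bij_betw (f(i := x)) (insert i J) (insert x A)"
    using assms(2,3) notIn_Un_bij_betw[of i J "f(i := x)" A] by simp
  then show ?thesis using assms unfolding sdr_def by auto
qed

lemma sdr_restrict:
  assumes "sdr S J A f" "K \<subseteq> J"
  shows "sdr S K (f ` K) f"
  using assms unfolding sdr_def bij_betw_def by (auto intro: inj_on_subset)

lemma sdr_remove:
  assumes "sdr S J A f" "i \<in> J"
  shows "sdr S (J - {i}) (A - {f i}) f"
proof -
  have "f ` (J - {i}) = A - {f i}"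
    using assms unfolding sdr_def bij_betw_def inj_on_def by blast
  with sdr_restrict[OF assms(1), of "J - {i}"] show ?thesis by auto
qed

lemma sdr_mono:
  assumes "sdr S J A f" "\<And>k. k \<in> J \<Longrightarrow> k \<in> S (f k) \<Longrightarrow> k \<in> T (f k)"
  shows "sdr T J A f"
  using assms unfolding sdr_def by auto

section \<open>Long lines in set systems\<close>

lemma card_le_of_singleton_supports:
  assumes "finite J" "\<And>e. e \<in> E \<Longrightarrow> \<exists>i\<in>J. S e = {i}"
    and "\<And>e f i. e \<in> E \<Longrightarrow> f \<in> E \<Longrightarrow> S e = {i} \<Longrightarrow> S f = {i} \<Longrightarrow> e = f"
  shows "card E \<le> card J"
proof -
  obtain g where g: "\<And>e. e \<in> E \<Longrightarrow> g e \<in> J \<and> S e = {g e}"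
    using assms(2) by metis
  then have "inj_on g E" using assms(3) by (metis inj_onI)
  with g show ?thesis using assms(1) by (intro card_inj_on_le[of g]) auto
qed

text \<open>By Hall's condition for sets of size one and two, the assumptions on \<open>S\<close>
  say that the transversal matroid presented by \<open>S\<close> on \<open>E\<close> is simple; the
  matching \<open>m\<close> says that it has full rank \<open>card J\<close>. Both properties must
  be restored after the indices \<open>i\<close> and \<open>j\<close> are merged.\<close>

lemma exists_line_minor:
  fixes S :: "'a \<Rightarrow> 'i set"
  assumes "l \<ge> 1" "finite E" "finite J" "J \<noteq> {}"
    and "\<And>e. e \<in> E \<Longrightarrow> S e \<subseteq> J \<and> S e \<noteq> {}"
    and "\<And>e f i. e \<in> E \<Longrightarrow> f \<in> E \<Longrightarrow> S e = {i} \<Longrightarrow> S f = {i} \<Longrightarrow> e = f"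
    and "sdr S J B m" "B \<subseteq> E"
    and "card E \<ge> l * (card J - 1) + 2"
  shows "\<exists>C X. C \<subseteq> E \<and> X \<subseteq> E \<and> C \<inter> X = {} \<and> card X = l + 2 \<and>
    (\<forall>x\<in>X. \<forall>y\<in>X. x \<noteq> y \<longrightarrow> (\<exists>f. sdr S J (C \<union> {x, y}) f))"
  using assms(2-)
proof (induction "card J" arbitrary: J E S B m rule: less_induct)
  case less
  note finE = less.prems(1) and finJ = less.prems(2) and supp = less.prems(4)
    and single = less.prems(5) and m = less.prems(6) and BE = less.prems(7)
    and large = less.prems(8)
  have mS: "k \<in> S (m k)" and mE: "m k \<in> E" if "k \<in> J" for k
    using that m BE unfolding sdr_def bij_betw_def by auto
  have minj: "k = k'" if "m k = m k'" "k \<in> J" "k' \<in> J" for k k'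
    using that m unfolding sdr_def bij_betw_def inj_on_def by auto
  have "\<exists>e\<in>E. \<forall>i. S e \<noteq> {i}"
  proof (rule ccontr)
    assume "\<not> ?thesis"
    then have "\<exists>i\<in>J. S f = {i}" if "f \<in> E" for f
      using supp[OF that] that by fastforce
    then have "card E \<le> card J"
      using card_le_of_singleton_supports[of J E S] finJ single by presburger
    moreover obtain n where "card J = Suc n"
      using finJ \<open>J \<noteq> {}\<close> by (metis card_gt_0_iff gr0_conv_Suc)
    moreover have "n \<le> l * n" using \<open>l \<ge> 1\<close> by (cases l) auto
    ultimately show False using large by (metis Suc_1 add_2_eq_Suc' diff_Suc_1 le_trans not_less_eq_eq Suc_le_mono)
  qed
  then obtain e where e: "e \<in> E" "\<And>i. S e \<noteq> {i}" by blast
  \<comment> \<open>An index matched to \<open>e\<close> must survive the shrinking of \<open>S e\<close> to \<open>{i, j}\<close>.\<close>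
  obtain i where i: "i \<in> S e" "\<And>k. k \<in> J \<Longrightarrow> m k = e \<Longrightarrow> k = i"
  proof (cases "e \<in> m ` J")
    case True
    then show ?thesis using that mS minj by blast
  next
    case False
    then show ?thesis using that supp[OF e(1)] by blast
  qed
  obtain j where j: "j \<in> S e" "j \<noteq> i" using e i by blast
  have ijJ: "i \<in> J" "j \<in> J" using supp e i j by auto
  \<comment> \<open>\<open>S\<close> itself is left unchanged: the shrinking of \<open>S e\<close>
    to \<open>{i, j}\<close> is simulated by putting \<open>e\<close> into \<open>L\<close> by
    hand.\<close>
  define L where "L = {f\<in>E. f = e \<or> S f \<subseteq> {i, j}}"
  have finL: "finite L" and eL: "e \<in> L" and LE: "L \<subseteq> E" using finE e by (auto simp: L_def)
  \<comment> \<open>\<open>m k\<close> has \<open>k\<close> in its support, so it could lie in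
    \<open>L\<close> only as \<open>e\<close>, which the choice of \<open>i\<close>
    excludes.\<close>
  have m_notin_L: "m k \<notin> L" if "k \<in> J - {i, j}" for k
    using that mS[of k] i(2)[of k] unfolding L_def by auto
  show ?case
  proof (cases "card L \<ge> l + 2")
    case True
    then obtain X where X: "X \<subseteq> L" "card X = l + 2" by (meson obtain_subset_with_card_n)
    define C where "C = m ` (J - {i, j})"
    have disj: "C \<inter> L = {}" using m_notin_L by (auto simp: C_def)
    have C: "sdr S (J - {i, j}) C m" unfolding C_def by (rule sdr_restrict[OF m]) auto
    have ord: "\<exists>f. sdr S J (C \<union> {a, b}) f"
      if "a \<in> L" "b \<in> L" "a \<noteq> b" "i \<in> S a" "j \<in> S b" for a b
    proof -
      have "sdr S (insert i (J - {i, j})) (insert a C) (m(i := a))"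
        using disj that by (intro sdr_upd[OF C]) auto
      then have "sdr S (insert j (insert i (J - {i, j}))) (insert b (insert a C)) (m(i := a, j := b))"
        using disj that j(2) by - (rule sdr_upd, auto)
      moreover have "insert j (insert i (J - {i, j})) = J" using ijJ by auto
      moreover have "insert b (insert a C) = C \<union> {a, b}" by auto
      ultimately show ?thesis by auto
    qed
    have "\<exists>f. sdr S J (C \<union> {x, y}) f" if xy: "x \<in> X" "y \<in> X" "x \<noteq> y" for x y
    proof -
      have L: "x \<in> L" "y \<in> L" using xy X by auto
      have kinds: "S z = {i} \<or> S z = {j} \<or> {i, j} \<subseteq> S z" if "z \<in> L" for z
      proof -
        have "S z \<noteq> {}" using that LE supp by auto
        then show ?thesis using that i(1) j(1) unfolding L_def by blast
      qed
      \<comment> \<open>Distinct elements of \<open>L\<close> share no singleton support, so one of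
        them can take \<open>i\<close> and the other \<open>j\<close>.\<close>
      have "(i \<in> S x \<and> j \<in> S y) \<or> (i \<in> S y \<and> j \<in> S x)"
        using kinds[OF L(1)] kinds[OF L(2)] single[of x y] L LE xy(3) by blast
      then show ?thesis using ord[of x y] ord[of y x] L xy(3) by (metis insert_commute)
    qed
    moreover have "C \<subseteq> E" using mE by (auto simp: C_def)
    moreover have "X \<subseteq> E" "C \<inter> X = {}" using X disj LE by auto
    ultimately show ?thesis using X(2) by (intro exI[of _ C] exI[of _ X]) auto
  next
    case False
    \<comment> \<open>In \<open>S'\<close> the index \<open>i\<close> stands for the merged
      pair.\<close>
    define S' where "S' f = (if S f \<inter> {i, j} = {} then S f else insert i (S f - {j}))" for f
    define J' where "J' = J - {j}"
    \<comment> \<open>\<open>Z\<close> keeps one representative of the point to which the line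
      collapses, if there is one. When \<open>L = {e}\<close> a single element is lost, and
      \<open>l \<ge> 1\<close> pays for it; otherwise \<open>card L - 1 \<le> l\<close> elements are
      lost.\<close>
    obtain Z where Z: "Z \<subseteq> L - {e}" "card L \<le> l + card Z"
      and Z1: "\<And>y z. y \<in> Z \<Longrightarrow> z \<in> Z \<Longrightarrow> y = z" and Z0: "Z = {} \<Longrightarrow> L = {e}"
    proof (cases "L = {e}")
      case True
      then show ?thesis using that[of "{}"] \<open>l \<ge> 1\<close> by auto
    next
      case False
      then obtain z where "z \<in> L - {e}" using eL by auto
      then show ?thesis using that[of "{z}"] \<open>\<not> l + 2 \<le> card L\<close> by auto
    qed
    define E' where "E' = (E - L) \<union> Z"
    have E'E: "E' \<subseteq> E" and eE': "e \<notin> E'" using Z LE eL by (auto simp: E'_def)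
    have finZ: "finite Z" using Z finL finite_subset by blast
    have "card E' = card E - card L + card Z"
      unfolding E'_def using Z finE finL LE finZ
      by (subst card_Un_disjoint) (auto simp: card_Diff_subset)
    moreover have "card L \<le> card E" using card_mono finE LE by blast
    ultimately have cardE': "card E \<le> card E' + l" using Z by linarith
    have finJ': "finite J'" using finJ by (simp add: J'_def)
    have iJ': "i \<in> J'" using ijJ j by (simp add: J'_def)
    have cardJ: "card J = Suc (card J')" using ijJ finJ by (metis J'_def card_Suc_Diff1)
    have cardJ': "card J' \<ge> 1" using iJ' finJ' by (metis One_nat_def Suc_leI card_gt_0_iff empty_iff)
    have S'Z: "S' z = {i}" if "z \<in> Z" for z
      using that Z supp[of z] j(2) unfolding S'_def L_def by (auto split: if_splits)
    have supp': "S' f \<subseteq> J' \<and> S' f \<noteq> {}" if "f \<in> E'" for f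
      using supp[of f] that E'E ijJ j(2) unfolding S'_def J'_def by (auto split: if_splits)
    \<comment> \<open>An element outside \<open>L\<close> whose support meets \<open>{i, j}\<close>
      has a further index in it, so merging gives it no singleton support.\<close>
    have outside: "S f = {k} \<and> k \<noteq> i" if "f \<in> E - L" "S' f = {k}" for f k
      using that j(2) unfolding S'_def L_def by (auto split: if_splits)
    have single': "f = g" if fg: "f \<in> E'" "g \<in> E'" "S' f = {k}" "S' g = {k}" for f g k
    proof (cases "k = i")
      case True
      then show ?thesis using fg outside Z1 unfolding E'_def by blast
    next
      case False
      then have "f \<in> E - L" "g \<in> E - L" using fg S'Z unfolding E'_def by auto
      then show ?thesis using outside fg single[of f g k] by auto
    qed
    have Ssub: "k \<in> S f" if "k \<in> S' f" "k \<noteq> i" for k f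
      using that unfolding S'_def by (auto split: if_splits)
    have S'i: "i \<in> S' f" if "i \<in> S f \<or> j \<in> S f" for f
      using that unfolding S'_def by auto
    let ?R = "J - {i, j}"
    have R: "sdr S' ?R (m ` ?R) m"
      by (rule sdr_mono[OF sdr_restrict[OF m]]) (auto simp: S'_def)
    have mR: "m ` ?R \<subseteq> E - L" using m_notin_L mE by auto
    have J'_eq: "insert i ?R = J'" using ijJ j by (auto simp: J'_def)
    \<comment> \<open>Full rank after merging requires a new partner for \<open>i\<close>. It is the
      element of \<open>Z\<close>, or, when only \<open>e\<close> is removed, whichever of
      \<open>m i\<close> and \<open>m j\<close> is not \<open>e\<close>.\<close>
    obtain a where a: "a \<in> E'" "a \<notin> m ` ?R" "i \<in> S' a"
    proof (cases "Z = {}")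
      case False
      then obtain z where "z \<in> Z" by auto
      then show ?thesis using that[of z] S'Z mR Z unfolding E'_def by blast
    next
      case True
      then have "L = {e}" using Z0 by simp
      define k where "k = (if m i = e then j else i)"
      have k: "k \<in> {i, j}" "k \<in> J" "m k \<noteq> e"
        using ijJ minj[of i j] j(2) by (auto simp: k_def)
      then have "m k \<notin> m ` ?R" using minj by blast
      moreover have "m k \<in> E'" using \<open>L = {e}\<close> k mE unfolding E'_def by auto
      moreover have "i \<in> S' (m k)" using S'i mS[of k] k by auto
      ultimately show ?thesis using that by blast
    qed
    have m': "sdr S' J' (insert a (m ` ?R)) (m(i := a))"
      using sdr_upd[OF R _ a(2,3)] J'_eq by simp
    have BE': "insert a (m ` ?R) \<subseteq> E'" using mR a(1) unfolding E'_def by auto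
    have "l * (card J - 1) = l * (card J' - 1) + l"
      using cardJ cardJ' by (cases "card J'") auto
    then have large': "card E' \<ge> l * (card J' - 1) + 2" using large cardE' by linarith
    have finE': "finite E'" using E'E finE finite_subset by blast
    have less: "card J' < card J" and ne: "J' \<noteq> {}" using cardJ iJ' by auto
    obtain C X where CX: "C \<subseteq> E'" "X \<subseteq> E'" "C \<inter> X = {}" "card X = l + 2"
      and f: "\<forall>x\<in>X. \<forall>y\<in>X. x \<noteq> y \<longrightarrow> (\<exists>f. sdr S' J' (C \<union> {x, y}) f)"
      using less.hyps[OF less finE' finJ' ne supp' _ m' BE' large'] single' by metis
    \<comment> \<open>This undoes the contraction: the element matched to the merged index has
      \<open>i\<close> or \<open>j\<close> in its original support and takes that one, while
      \<open>e\<close> takes the other.\<close>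
    have lift: "\<exists>g. sdr S J (insert e A) g" if f: "sdr S' J' A f" and A: "A \<subseteq> E'" for A f
    proof -
      have eA: "e \<notin> A" using A eE' by blast
      have fiA: "f i \<in> A" using f iJ' unfolding sdr_def bij_betw_def by auto
      have "i \<in> S' (f i)" using f iJ' unfolding sdr_def by auto
      then have fi: "i \<in> S (f i) \<or> j \<in> S (f i)" unfolding S'_def by (auto split: if_splits)
      have fR: "sdr S ?R (A - {f i}) f"
      proof -
        have "J' - {i} = ?R" by (auto simp: J'_def)
        then show ?thesis
          using sdr_mono[OF sdr_remove[OF f iJ'], of S] Ssub by auto
      qed
      have two: "\<exists>g. sdr S J (insert e A) g"
        if "p \<in> S (f i)" "q \<in> S e" "{p, q} = {i, j}" for p q
      proof -
        have pq: "p \<noteq> q" "p \<notin> ?R" "q \<notin> ?R" using that j(2) by (auto simp: doubleton_eq_iff)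
        have "sdr S (insert p ?R) (insert (f i) (A - {f i})) (f(p := f i))"
          using pq that by (intro sdr_upd[OF fR]) auto
        then have "sdr S (insert p ?R) A (f(p := f i))"
          using fiA by (simp add: insert_absorb)
        then have "sdr S (insert q (insert p ?R)) (insert e A) (f(p := f i, q := e))"
          using pq that eA by - (rule sdr_upd, auto)
        moreover have "insert q (insert p ?R) = J" using that(3) ijJ by auto
        ultimately show ?thesis by auto
      qed
      show ?thesis using fi two[of i j] two[of j i] i(1) j(1) by auto
    qed
    have "\<exists>g. sdr S J (insert e C \<union> {x, y}) g" if "x \<in> X" "y \<in> X" "x \<noteq> y" for x y
    proof -
      have "C \<union> {x, y} \<subseteq> E'" using CX that by auto
      moreover obtain h where "sdr S' J' (C \<union> {x, y}) h" using f \<open>x \<in> X\<close> \<open>y \<in> X\<close> \<open>x \<noteq> y\<close> by meson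
      ultimately show ?thesis using lift by (metis Un_insert_left)
    qed
    moreover have "insert e C \<subseteq> E" "X \<subseteq> E" "insert e C \<inter> X = {}"
      using CX E'E eE' e(1) by auto
    ultimately show ?thesis using CX(4) by (intro exI[of _ "insert e C"] exI[of _ X]) auto
  qed
qed

section \<open>Rank and uniform minors of rank two\<close>

lemma (in matroid) card_indep_le_rank:
  assumes "I \<in> indeps M"
  shows "card I \<le> matroid_rank M"
proof -
  have "indeps M \<subseteq> Pow (ground M)" using indep_subset_ground by auto
  then have "finite (indeps M)" using finite_ground finite_subset by blast
  then show ?thesis unfolding matroid_rank_def using assms by auto
qed

lemma (in matroid) obtain_indep_card_rank:
  obtains B where "B \<in> indeps M" "card B = matroid_rank M"
proof -
  have "indeps M \<subseteq> Pow (ground M)" using indep_subset_ground by auto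
  then have "finite (indeps M)" using finite_ground finite_subset by blast
  then have "Max (card ` indeps M) \<in> card ` indeps M" using empty_indep by (intro Max_in) auto
  then show ?thesis using that unfolding matroid_rank_def by (metis imageE)
qed

text \<open>The minor comes from contracting \<open>C\<close> and deleting all that lies outside
  \<open>C\<close> and \<open>X\<close>. The rank of \<open>M\<close> is \<open>card C + 2\<close>,
  so at most two elements of \<open>X\<close> can be added to \<open>C\<close>, and any two can by
  \<open>bases\<close>.\<close>

lemma (in matroid) uniform_minor_rank_2:
  assumes "C \<subseteq> ground M" "X \<subseteq> ground M" "C \<inter> X = {}" "card X \<ge> 2"
    and bases: "\<And>x y. x \<in> X \<Longrightarrow> y \<in> X \<Longrightarrow> x \<noteq> y \<Longrightarrow>
      C \<union> {x, y} \<in> indeps M \<and> card (C \<union> {x, y}) = matroid_rank M"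
  shows "\<exists>N. is_minor M N \<and> isomorphic_to N (uniform_matroid 2 (card X))"
proof -
  have finX: "finite X" and finC: "finite C" using assms finite_ground finite_subset by blast+
  obtain u v where uv: "u \<in> X" "v \<in> X" "u \<noteq> v"
    using \<open>card X \<ge> 2\<close> by (meson card_2_iff' obtain_subset_with_card_n subsetD)
  have Cin: "C \<in> indeps M" using indep_subset bases[OF uv] by blast
  have rank: "matroid_rank M = card C + 2"
  proof -
    have "card (C \<union> {u, v}) = card C + card {u, v}"
      using finC uv assms(3) by (intro card_Un_disjoint) auto
    then show ?thesis using bases[OF uv] uv by simp
  qed
  have indep_iff: "I \<union> C \<in> indeps M \<longleftrightarrow> card I \<le> 2" if I: "I \<subseteq> X" for I
  proof
    assume "I \<union> C \<in> indeps M"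
    then have "card (I \<union> C) \<le> card C + 2" using card_indep_le_rank rank by metis
    moreover have "card (I \<union> C) = card I + card C"
      using finX finC I assms(3) finite_subset by (intro card_Un_disjoint) blast+
    ultimately show "card I \<le> 2" by simp
  next
    assume "card I \<le> 2"
    then obtain T where T: "I \<subseteq> T" "T \<subseteq> X" "card T = 2"
      using exists_subset_between[of I 2 X] I finX assms(4) by blast
    then obtain x y where "T = {x, y}" "x \<noteq> y" by (auto simp: card_2_iff)
    then have "C \<union> T \<in> indeps M" using bases T by auto
    then show "I \<union> C \<in> indeps M" using T by (auto elim: indep_subset)
  qed
  define N where "N = delete (contract M C) (ground M - C - X)"
  have "is_minor M N" unfolding N_def
    by (intro minor_delete minor_contract minor_refl assms) (auto simp: contract_def)
  moreover have gN: "ground N = X" using assms(2,3) by (auto simp: N_def delete_def contract_def)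
  \<comment> \<open>As \<open>C\<close> is independent, it is its own only basis, which removes the
    existential from the contraction.\<close>
  moreover have basis: "is_basis_of M C A \<longleftrightarrow> A = C" for A
    using Cin unfolding is_basis_of_def by auto
  have iN: "I \<in> indeps N \<longleftrightarrow> card I \<le> 2" if "I \<subseteq> X" for I
    using that assms(2,3) indep_iff[OF that] by (auto simp: N_def delete_def contract_def basis)
  have "isomorphic_to N (uniform_matroid 2 (card X))"
  proof -
    obtain h where h: "bij_betw h X {..<card X}"
      using ex_bij_betw_finite_nat[OF finX] by (metis atLeast0LessThan)
    have "card (h ` I) = card I \<and> h ` I \<subseteq> {..<card X}" if "I \<subseteq> X" for I
      using that h unfolding bij_betw_def by (auto intro!: card_image elim: inj_on_subset)
    then show ?thesis unfolding isomorphic_to_def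
      using h gN iN by (auto simp: uniform_matroid_def intro!: exI[of _ h])
  qed
  ultimately show ?thesis by blast
qed

section \<open>From a presentation to a set system of full rank\<close>

text \<open>Inverting the injection makes the set of used indices explicit, so that it can be
  compared with the indices of a basis.\<close>

lemma presentation_indep_iff:
  assumes "presentation M b P"
  shows "A \<in> indeps M \<longleftrightarrow> A \<subseteq> ground M \<and> (\<exists>J\<subseteq>{1..b}. \<exists>f. sdr (\<lambda>x. {i. x \<in> P i}) J A f)"
proof (intro iffI conjI)
  assume "A \<in> indeps M"
  then obtain f where f: "A \<subseteq> ground M" "inj_on f A" "f ` A \<subseteq> {1..b}" "\<forall>x\<in>A. x \<in> P (f x)"
    using assms unfolding presentation_def by auto
  then show "A \<subseteq> ground M" by simp
  have "sdr (\<lambda>x. {i. x \<in> P i}) (f ` A) A (inv_into A f)"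
    unfolding sdr_def using f by (auto simp: inv_into_f_f intro: bij_betw_inv_into inj_on_imp_bij_betw)
  then show "\<exists>J\<subseteq>{1..b}. \<exists>f. sdr (\<lambda>x. {i. x \<in> P i}) J A f" using f by blast
next
  assume "A \<subseteq> ground M \<and> (\<exists>J\<subseteq>{1..b}. \<exists>f. sdr (\<lambda>x. {i. x \<in> P i}) J A f)"
  then obtain J f where A: "A \<subseteq> ground M" and J: "J \<subseteq> {1..b}" and f: "bij_betw f J A"
    "\<And>k. k \<in> J \<Longrightarrow> f k \<in> P k"
    unfolding sdr_def by auto
  have "bij_betw (inv_into J f) A J" using f bij_betw_inv_into by blast
  moreover have "x \<in> P (inv_into J f x)" if "x \<in> A" for x
    using that f by (metis bij_betw_def f_inv_into_f inv_into_into)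
  ultimately have "\<exists>g. inj_on g A \<and> g ` A \<subseteq> {1..b} \<and> (\<forall>x\<in>A. x \<in> P (g x))"
    using J unfolding bij_betw_def by blast
  then show "A \<in> indeps M" using assms A unfolding presentation_def by auto
qed

theorem corollary1p2:
  fixes M :: "'a indep_system" and l r :: nat
  assumes "l \<ge> 1" and "r \<ge> 1"
    and "simple_matroid M"
    and "transversal_matroid M"
    and "matroid_rank M = r"
    and "\<not> (\<exists>N. is_minor M N \<and> isomorphic_to N (uniform_matroid 2 (l + 2)))"
  shows "card (ground M) \<le> l * (r - 1) + 1"
proof (rule ccontr)
  assume "\<not> ?thesis"
  then have large: "card (ground M) \<ge> l * (r - 1) + 2" by simp
  interpret matroid M using assms(3) unfolding simple_matroid_def by blast
  have point: "{x} \<in> indeps M" if "x \<in> ground M" for x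
    using that assms(3) unfolding simple_matroid_def is_loop_def by blast
  have pair: "{x, y} \<in> indeps M" if "x \<in> ground M" "y \<in> ground M" "x \<noteq> y" for x y
    using that assms(3) unfolding simple_matroid_def is_parallel_pair_def by blast
  obtain b P where pres: "presentation M b P"
    using assms(4) unfolding transversal_matroid_def by blast
  define S where "S = (\<lambda>x. {i. x \<in> P i})"
  note indep_iff = presentation_indep_iff[OF pres, folded S_def]
  obtain B where B: "B \<in> indeps M" "card B = r"
    using obtain_indep_card_rank assms(5) by metis
  obtain J m where J: "J \<subseteq> {1..b}" and m: "sdr S J B m" using B indep_iff by blast
  have BE: "B \<subseteq> ground M" using B indep_subset_ground by blast
  have finJ: "finite J" using J finite_subset by blast
  have cardJ: "card J = r" using m B unfolding sdr_def by (metis bij_betw_same_card)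
  have finB: "finite B" using BE finite_ground finite_subset by blast
  have no_larger: False
    if "sdr S K (insert x B) f" "K \<subseteq> {1..b}" "x \<in> ground M" "x \<notin> B" for K x f
  proof -
    have "insert x B \<in> indeps M" using that indep_iff BE by blast
    then show False using card_indep_le_rank assms(5) B(2) that(4) finB by fastforce
  qed
  define T where "T = (\<lambda>x. S x \<inter> J)"
  \<comment> \<open>Otherwise matching \<open>k\<close> to \<open>x\<close> would extend
    \<open>B\<close> to an independent set of \<open>r + 1\<close> elements.\<close>
  have outside: "x \<in> B" if "x \<in> ground M" "k \<in> S x" "k \<in> {1..b} - J" for x k
    using sdr_upd[OF m, of k x] no_larger[of "insert k J" x] that J by blast
  have mT: "sdr T J B m" using m by (rule sdr_mono) (auto simp: T_def)
  have T_ne: "T x \<noteq> {}" if x: "x \<in> ground M" for x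
  proof (cases "x \<in> B")
    case True
    then show ?thesis using mT unfolding sdr_def bij_betw_def by auto
  next
    case False
    obtain K f where "K \<subseteq> {1..b}" "sdr S K {x} f" using indep_iff[of "{x}"] point[OF x] by auto
    then obtain k where "k \<in> S x" "k \<in> {1..b}"
      unfolding sdr_def bij_betw_def by (metis image_iff singletonI singletonD imageI subsetD)
    then show ?thesis using outside[OF x] False unfolding T_def by auto
  qed
  have T_single: "x = y"
    if xy: "x \<in> ground M" "y \<in> ground M" "T x = {i}" "T y = {i}" for x y i
  proof (rule ccontr)
    assume "x \<noteq> y"
    \<comment> \<open>The basis element \<open>u\<close> could be rematched to \<open>k\<close>, making room for \<open>v\<close> at the index \<open>i\<close>.\<close>
    have swap: False if u: "u \<in> ground M" "v \<in> ground M" "T u = {i}" "T v = {i}" "u \<noteq> v"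
      "k \<in> S u" "k \<in> {1..b} - J" for u v k
    proof -
      \<comment> \<open>The index matched to \<open>w\<close> by \<open>m\<close> lies in
        \<open>T w\<close>, hence is \<open>i\<close>.\<close>
      have uniq: "w = m i" if "w \<in> B" "T w = {i}" for w
        using mT that unfolding sdr_def bij_betw_def by (metis imageE singletonD)
      have uB: "u = m i" "u \<in> B" using uniq outside u by blast+
      then have vB: "v \<notin> B" using uniq u by blast
      have iJ: "i \<in> J" "i \<in> S v" using u unfolding T_def by auto
      have "sdr S (J - {i}) (B - {u}) m" using sdr_remove[OF m iJ(1)] uB by simp
      then have "sdr S (insert i (J - {i})) (insert v (B - {u})) (m(i := v))"
        using vB iJ by - (rule sdr_upd, auto)
      then have "sdr S J (insert v (B - {u})) (m(i := v))" using iJ by (simp add: insert_absorb)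
      then have "sdr S (insert k J) (insert u (insert v (B - {u}))) (m(i := v, k := u))"
        using u by - (rule sdr_upd, auto)
      moreover have "insert u (insert v (B - {u})) = insert v B" using uB by auto
      ultimately show False using no_larger[of "insert k J" v] vB u J by auto
    qed
    obtain K f where K: "K \<subseteq> {1..b}" "sdr S K {x, y} f"
      using indep_iff[of "{x, y}"] pair[OF xy(1,2) \<open>x \<noteq> y\<close>] by auto
    then obtain p q where pq: "p \<in> K" "q \<in> K" "f p = x" "f q = y"
      unfolding sdr_def bij_betw_def by (metis imageE insertCI)
    then have "p \<noteq> q" "p \<in> S x" "q \<in> S y" using K \<open>x \<noteq> y\<close> unfolding sdr_def by auto
    moreover have "p \<in> {1..b}" "q \<in> {1..b}" using pq K by auto
    \<comment> \<open>If both indices were in \<open>J\<close>, both would equal \<open>i\<close>,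
      although \<open>p \<noteq> q\<close>.\<close>
    ultimately have "p \<in> {1..b} - J \<or> q \<in> {1..b} - J"
      using xy unfolding T_def by (metis Int_iff DiffI singletonD)
    then show False
      using swap[of x y p] swap[of y x q] xy \<open>x \<noteq> y\<close> \<open>p \<in> S x\<close> \<open>q \<in> S y\<close> by auto
  qed
  have Jne: "J \<noteq> {}" using cardJ assms(2) by auto
  have T_supp: "T x \<subseteq> J \<and> T x \<noteq> {}" if "x \<in> ground M" for x
    using T_ne[OF that] by (auto simp: T_def)
  have "card (ground M) \<ge> l * (card J - 1) + 2" using large cardJ by simp
  then obtain C X where CX: "C \<subseteq> ground M" "X \<subseteq> ground M" "C \<inter> X = {}" "card X = l + 2"
    and f: "\<forall>x\<in>X. \<forall>y\<in>X. x \<noteq> y \<longrightarrow> (\<exists>f. sdr T J (C \<union> {x, y}) f)"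
    using exists_line_minor[OF assms(1) finite_ground finJ Jne T_supp _ mT BE] T_single by metis
  have "C \<union> {x, y} \<in> indeps M \<and> card (C \<union> {x, y}) = matroid_rank M"
    if xy: "x \<in> X" "y \<in> X" "x \<noteq> y" for x y
  proof -
    obtain g where g: "sdr T J (C \<union> {x, y}) g" using f xy by blast
    then have "sdr S J (C \<union> {x, y}) g" by (rule sdr_mono) (auto simp: T_def)
    then have "C \<union> {x, y} \<in> indeps M" using indep_iff[of "C \<union> {x, y}"] J CX xy by auto
    moreover have "card (C \<union> {x, y}) = r"
      using g cardJ unfolding sdr_def by (metis bij_betw_same_card)
    ultimately show ?thesis using assms(5) by simp
  qed
  then show False using uniform_minor_rank_2[OF CX(1-3)] CX(4) assms(6) by simp
qed

end
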